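(* For $n\ge1$ let $V_n:=\sum_{w\in\mathcal F_{n,2}}\mathrm{ver}(G(w))$ and $D^{(4)}_n:=\sum_{w\in\mathcal F_{n,2}}\deg_4(G(w))$. Then $$\lim_{n\to\infty}\frac{D^{(4)}_n}{V_n}=\frac{7-\sqrt5}{22}.$$
   Context: $\mathcal F_{n,2}$ is the set of binary words $w=w_1\cdots w_n$ with no two consecutive $1$'s. $P(w)$ is the bargraph polyomino formed by the unit squares $[i-1,i]\times[j-1,j]$, $1\le i\le n$, $1\le j\le w_i+1$. $G(w)$ is the graph whose vertices are the corners of the cells of $P(w)$ and whose edges are the cell sides. $\mathrm{ver}(G)$ is the number of vertices of $G$ and $\deg_4(G)$ the number of vertices of degree $4$. *)

theory Defs
  imports Complex_Main
begin

text \<open>The letter \<open>w\<^sub>i\<close> (\<open>1 \<le> i \<le> n\<close>) of a word is the list element \<open>w ! (i - 1)\<close>.\<close>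

definition fib_words :: "nat \<Rightarrow> nat list set" where
  "fib_words n =
     {w. length w = n \<and> set w \<subseteq> {0, 1} \<and>
         (\<forall>i. 1 \<le> i \<and> i < n \<longrightarrow> \<not> (w ! (i - 1) = 1 \<and> w ! i = 1))}"

text \<open>The pair \<open>(i, j)\<close> stands for the unit square \<open>[i - 1, i] \<times> [j - 1, j]\<close>.\<close>

definition cells :: "nat list \<Rightarrow> (nat \<times> nat) set" where
  "cells w = {(i, j). 1 \<le> i \<and> i \<le> length w \<and> 1 \<le> j \<and> j \<le> w ! (i - 1) + 1}"

fun cell_corners :: "nat \<times> nat \<Rightarrow> (nat \<times> nat) set" where
  "cell_corners (i, j) = {(i - 1, j - 1), (i, j - 1), (i - 1, j), (i, j)}"

fun cell_sides :: "nat \<times> nat \<Rightarrow> (nat \<times> nat) set set" where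
  "cell_sides (i, j) =
     {{(i - 1, j - 1), (i, j - 1)}, {(i - 1, j), (i, j)},
      {(i - 1, j - 1), (i - 1, j)}, {(i, j - 1), (i, j)}}"

text \<open>A graph is a pair of a vertex set and a set of two-element vertex sets.\<close>

type_synonym 'v ugraph = "'v set \<times> 'v set set"

definition bargraph_graph :: "nat list \<Rightarrow> (nat \<times> nat) ugraph" where
  "bargraph_graph w = (\<Union>c\<in>cells w. cell_corners c, \<Union>c\<in>cells w. cell_sides c)"

definition ver :: "'v ugraph \<Rightarrow> nat" where
  "ver G = card (fst G)"

definition degree :: "'v ugraph \<Rightarrow> 'v \<Rightarrow> nat" where
  "degree G v = card {e \<in> snd G. v \<in> e}"

definition deg4 :: "'v ugraph \<Rightarrow> nat" where
  "deg4 G = card {v \<in> fst G. degree G v = 4}"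

definition total_ver :: "nat \<Rightarrow> nat" where
  "total_ver n = (\<Sum>w\<in>fib_words n. ver (bargraph_graph w))"

definition total_deg4 :: "nat \<Rightarrow> nat" where
  "total_deg4 n = (\<Sum>w\<in>fib_words n. deg4 (bargraph_graph w))"

end

theory Submission
  imports Defs "HOL-Number_Theory.Fib"
begin

text \<open>
  For a Fibonacci word \<open>w\<close> of length \<open>n \<ge> 1\<close> with \<open>k\<close> ones, the graph has \<open>2(n + 1)\<close> vertices at
  heights 0 and 1, and, since no two ones are adjacent, exactly two further vertices at height 2 per
  one. The vertices of degree 4 are the bottom corners of the upper cells, except those on the left
  or right boundary, so there are between \<open>2k - 2\<close> and \<open>2k\<close> of them. If \<open>\<rho>\<close> denotes the limiting
  density of ones, the ratio therefore tends to \<open>2\<rho> / (2 + 2\<rho>)\<close>. Counting words by their first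
  letter gives \<open>F\<^bsub>n+2\<^esub>\<close> words with \<open>(n F\<^bsub>n+1\<^esub> + 2(n + 1) F\<^sub>n) / 5\<close> ones in
  total, whence \<open>\<rho> = (5 - \<surd>5) / 10\<close>.
\<close>

section \<open>Recursive structure and number of Fibonacci words\<close>

lemma fib_words_0: "fib_words 0 = {[]}"
  by (auto simp: fib_words_def)

lemma fib_words_1: "fib_words (Suc 0) = {[0], [1]}"
  by (auto simp: fib_words_def length_Suc_conv)

lemma fib_words_iff:
  "w \<in> fib_words n \<longleftrightarrow> length w = n \<and> set w \<subseteq> {0, 1} \<and>
     (\<forall>i. Suc i < n \<longrightarrow> \<not> (w ! i = 1 \<and> w ! Suc i = 1))"
proof -
  have "(\<forall>i. 1 \<le> i \<and> i < n \<longrightarrow> \<not> (w ! (i - 1) = 1 \<and> w ! i = 1)) \<longleftrightarrow>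
    (\<forall>i. Suc i < n \<longrightarrow> \<not> (w ! i = 1 \<and> w ! Suc i = 1))"
    by (auto simp: gr0_conv_Suc Suc_le_eq)
  then show ?thesis by (simp add: fib_words_def)
qed

lemma Cons_in_fib_words_iff:
  "a # w \<in> fib_words (Suc n) \<longleftrightarrow>
     a \<in> {0, 1} \<and> w \<in> fib_words n \<and> (n > 0 \<longrightarrow> \<not> (a = 1 \<and> w ! 0 = 1))"
  unfolding fib_words_iff by (auto simp: all_conj_distrib nth_Cons split: nat.splits)

text \<open>A leading 0 leaves the rest of the word free, while a leading 1 forces the next letter
  to be 0.\<close>

lemma fib_words_Suc_Suc:
  "fib_words (Suc (Suc n)) =
     (#) 0 ` fib_words (Suc n) \<union> (\<lambda>w. 1 # 0 # w) ` fib_words n" (is "?L = ?R")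
proof
  show "?L \<subseteq> ?R"
  proof
    fix w assume w: "w \<in> ?L"
    then have "length w = Suc (Suc n)" by (simp add: fib_words_def)
    then obtain a b u where "w = a # b # u" by (auto simp: length_Suc_conv)
    with w show "w \<in> ?R" by (auto simp: Cons_in_fib_words_iff)
  qed
  show "?R \<subseteq> ?L" by (auto simp: Cons_in_fib_words_iff)
qed

lemma finite_fib_words: "finite (fib_words n)"
  by (induction n rule: fib.induct) (simp_all add: fib_words_0 fib_words_1 fib_words_Suc_Suc)

text \<open>The two families of words differ in their first letter and both prefixing maps are
  injective. Constant \<open>f\<close> yields the recurrence for the number of words,
  \<open>count_list\<close> that for the number of ones.\<close>

lemma sum_fib_words_Suc_Suc:
  "sum f (fib_words (Suc (Suc n))) =
     (\<Sum>w\<in>fib_words (Suc n). f (0 # w)) + (\<Sum>w\<in>fib_words n. f (1 # 0 # w))"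
  unfolding fib_words_Suc_Suc
  by (subst sum.union_disjoint) (auto simp: finite_fib_words sum.reindex inj_on_def)

lemma card_fib_words: "card (fib_words n) = fib (n + 2)"
proof (induction n rule: fib.induct)
  case (3 n)
  then show ?case
    using sum_fib_words_Suc_Suc[of "\<lambda>_. 1 :: nat" n] by simp
qed (simp_all add: fib_words_0 fib_words_1 numeral_2_eq_2)

section \<open>Number and positions of the ones\<close>

definition total_ones :: "nat \<Rightarrow> nat" where
  "total_ones n = (\<Sum>w\<in>fib_words n. count_list w 1)"

lemma total_ones_closed_form:
  "5 * total_ones n = n * fib (n + 1) + 2 * (n + 1) * fib n"
proof (induction n rule: fib.induct)
  case (3 n)
  \<comment> \<open>Each of the \<open>fib (n + 2)\<close> words of length \<open>n\<close>, when
    prefixed by 1 and 0, gains one further 1.\<close>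
  have "total_ones (Suc (Suc n)) = total_ones (Suc n) + total_ones n + fib (n + 2)"
    using sum_fib_words_Suc_Suc[of "\<lambda>w. count_list w 1" n]
    by (simp add: total_ones_def sum_Suc card_fib_words)
  with 3 show ?case by (simp add: algebra_simps)
qed (simp_all add: total_ones_def fib_words_0 fib_words_1)

definition ones :: "nat list \<Rightarrow> nat set" where
  "ones w = {i. i < length w \<and> w ! i = 1}"

lemma finite_ones: "finite (ones w)"
  by (simp add: ones_def)

lemma card_ones: "card (ones w) = count_list w 1"
  by (simp add: ones_def count_list_eq_length_filter length_filter_conv_card eq_commute)

lemma fib_word_nth:
  assumes "w \<in> fib_words n" "i < n"
  shows "w ! i = (if i \<in> ones w then 1 else 0)"
proof -
  have "w ! i \<in> {0, 1}"
    using assms nth_mem[of i w] unfolding fib_words_iff by blast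
  then show ?thesis
    using assms by (auto simp: fib_words_iff ones_def)
qed

text \<open>A common element would be the abscissa between two adjacent ones.\<close>

lemma ones_disjoint_shift:
  assumes "w \<in> fib_words n"
  shows "ones w \<inter> Suc ` ones w = {}"
  using assms by (auto simp: fib_words_iff ones_def)

lemma card_ones_union_shift:
  assumes "w \<in> fib_words n"
  shows "card (ones w \<union> Suc ` ones w) = 2 * card (ones w)"
  using ones_disjoint_shift[OF assms]
  by (simp add: card_Un_disjoint finite_ones card_image)

section \<open>Vertices of the graph\<close>

lemma vertex_iff:
  "(x, y) \<in> fst (bargraph_graph w) \<longleftrightarrow>
     (x < length w \<and> y \<le> w ! x + 1) \<or> (\<exists>i<length w. x = Suc i \<and> y \<le> w ! i + 1)"
    (is "?L \<longleftrightarrow> ?R")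
proof
  assume ?L
  then obtain i j where "(i, j) \<in> cells w" "(x, y) \<in> cell_corners (i, j)"
    by (auto simp: bargraph_graph_def)
  then show ?R by (cases i) (auto simp: cells_def)
next
  assume ?R
  then obtain i where i: "i < length w" "x = i \<or> x = Suc i" "y \<le> w ! i + 1" by blast
  \<comment> \<open>The point is an upper corner of the cell in row \<open>y\<close>. Rows start at
    1, so for \<open>y = 0\<close> it is taken as a lower corner in row 1.\<close>
  define j where "j = (if y = 0 then 1 else y)"
  have "(Suc i, j) \<in> cells w" "(x, y) \<in> cell_corners (Suc i, j)"
    using i by (auto simp: cells_def j_def)
  then show ?L unfolding bargraph_graph_def by (simp del: cell_corners.simps) blast
qed

text \<open>Slicing by height: rows 0 and 1 are complete, and height 2 occurs only over the sides of
  columns of height 2. The empty word has no cells and hence no vertices, so it is excluded.\<close>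

lemma ver_bargraph_graph:
  assumes w: "w \<in> fib_words n" and n: "n > 0"
  shows "ver (bargraph_graph w) = 2 * (n + 1) + 2 * count_list w 1"
proof -
  let ?T = "ones w \<union> Suc ` ones w"
  have len: "length w = n" using w by (simp add: fib_words_iff)
  have T: "?T \<subseteq> {..n}" by (auto simp: ones_def len)
  have "fst (bargraph_graph w) = {..n} \<times> {0, 1} \<union> ?T \<times> {2}"
  proof (intro set_eqI, clarify)
    fix x y :: nat
    have *: "y \<le> w ! i + 1 \<longleftrightarrow> y \<in> {0, 1} \<or> (i \<in> ones w \<and> y = 2)" if "i < n" for i
      using fib_word_nth[OF w that] by auto
    have "(x, y) \<in> fst (bargraph_graph w) \<longleftrightarrow>
        (x < n \<and> (y \<in> {0, 1} \<or> (x \<in> ones w \<and> y = 2))) \<or>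
        (\<exists>i<n. x = Suc i \<and> (y \<in> {0, 1} \<or> (i \<in> ones w \<and> y = 2)))"
      unfolding vertex_iff len using * by blast
    also have "\<dots> \<longleftrightarrow> (x \<le> n \<and> y \<in> {0, 1}) \<or> (x \<in> ?T \<and> y = 2)"
      using n by (cases x) (auto simp: ones_def len)
    finally show "(x, y) \<in> fst (bargraph_graph w) \<longleftrightarrow>
        (x, y) \<in> {..n} \<times> {0, 1} \<union> ?T \<times> {2}" by auto
  qed
  moreover have "card ({..n} \<times> {0, 1::nat} \<union> ?T \<times> {2}) = 2 * (n + 1) + card ?T"
    by (subst card_Un_disjoint) (auto simp: finite_ones card_cartesian_product)
  ultimately show ?thesis
    by (simp add: ver_def card_ones_union_shift[OF w] card_ones)
qed

section \<open>Edges and vertices of degree 4\<close>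

lemma horizontal_edge_iff:
  "{(a, b), (Suc a, b)} \<in> snd (bargraph_graph w) \<longleftrightarrow> a < length w \<and> b \<le> w ! a + 1"
    (is "?L \<longleftrightarrow> ?R")
proof
  assume ?L
  then obtain i j where "(i, j) \<in> cells w" "{(a, b), (Suc a, b)} \<in> cell_sides (i, j)"
    by (auto simp: bargraph_graph_def)
  then show ?R by (cases i) (auto simp: cells_def doubleton_eq_iff)
next
  assume R: ?R
  define j where "j = (if b = 0 then 1 else b)"
  have "(Suc a, j) \<in> cells w" "{(a, b), (Suc a, b)} \<in> cell_sides (Suc a, j)"
    using R by (auto simp: cells_def j_def)
  then show ?L unfolding bargraph_graph_def by (simp del: cell_sides.simps) blast
qed

text \<open>The edge bounds a cell in row \<open>Suc b\<close>, lying in the column to its right or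
  to its left; hence the bound is \<open>w ! a\<close> and not \<open>w ! a + 1\<close>.\<close>

lemma vertical_edge_iff:
  "{(a, b), (a, Suc b)} \<in> snd (bargraph_graph w) \<longleftrightarrow>
     (a < length w \<and> b \<le> w ! a) \<or> (\<exists>i<length w. a = Suc i \<and> b \<le> w ! i)"
    (is "?L \<longleftrightarrow> ?R")
proof
  assume ?L
  then obtain i j where "(i, j) \<in> cells w" "{(a, b), (a, Suc b)} \<in> cell_sides (i, j)"
    by (auto simp: bargraph_graph_def)
  then show ?R by (cases i) (auto simp: cells_def doubleton_eq_iff)
next
  assume ?R
  then obtain i where i: "i < length w" "a = i \<or> a = Suc i" "b \<le> w ! i" by blast
  then have "(Suc i, Suc b) \<in> cells w" "{(a, b), (a, Suc b)} \<in> cell_sides (Suc i, Suc b)"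
    by (auto simp: cells_def)
  then show ?L unfolding bargraph_graph_def by (simp del: cell_sides.simps) blast
qed

lemma edge_cases:
  assumes "e \<in> snd (bargraph_graph w)"
  obtains a b where "e = {(a, b), (Suc a, b)}" | a b where "e = {(a, b), (a, Suc b)}"
proof -
  obtain i j where ij: "(i, j) \<in> cells w" "e \<in> cell_sides (i, j)"
    using assms by (auto simp: bargraph_graph_def)
  then obtain i' j' where "i = Suc i'" "j = Suc j'"
    by (cases i; cases j) (auto simp: cells_def)
  with ij that show thesis by auto
qed

text \<open>A lattice point has at most one incident edge in each of the four directions, so degree
  4 means that all four are present.\<close>

lemma degree_eq_4_iff:
  "degree (bargraph_graph w) (x, y) = 4 \<longleftrightarrow>
     (\<exists>x' y'. x = Suc x' \<and> y = Suc y' \<and>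
       {{(x', y), (x, y)}, {(x, y), (Suc x, y)}, {(x, y'), (x, y)}, {(x, y), (x, Suc y)}}
         \<subseteq> snd (bargraph_graph w))"
    (is "?L \<longleftrightarrow> ?R")
proof -
  let ?E = "{e \<in> snd (bargraph_graph w). (x, y) \<in> e}"
  \<comment> \<open>On a coordinate axis the truncated subtraction turns one of these sets into the
    singleton of \<open>(x, y)\<close>, which \<open>no_loop\<close> rules out as an edge.\<close>
  let ?Q = "{{(x - 1, y), (x, y)}, {(x, y), (Suc x, y)}, {(x, y - 1), (x, y)}, {(x, y), (x, Suc y)}}"
  have sub: "?E \<subseteq> ?Q"
  proof
    fix e assume "e \<in> ?E"
    then have "e \<in> snd (bargraph_graph w)" "(x, y) \<in> e" by auto
    then show "e \<in> ?Q" by (cases rule: edge_cases) auto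
  qed
  have no_loop: "{v} \<notin> snd (bargraph_graph w)" for v
  proof
    assume "{v} \<in> snd (bargraph_graph w)"
    then show False by (cases rule: edge_cases) auto
  qed
  have card_Q: "card ?Q \<le> 4"
    by (simp add: card_insert_if)
  show ?thesis
  proof
    assume ?L
    then have "?E = ?Q"
      using card_Q by (intro card_seteq[OF _ sub]) (auto simp: degree_def)
    then have Q: "?Q \<subseteq> snd (bargraph_graph w)" by blast
    have "x \<noteq> 0"
    proof
      assume "x = 0"
      with Q no_loop[of "(x, y)"] show False by simp
    qed
    moreover have "y \<noteq> 0"
    proof
      assume "y = 0"
      with Q no_loop[of "(x, y)"] show False by simp
    qed
    ultimately show ?R using Q by (cases x; cases y) auto
  next
    assume ?R
    then obtain x' y' where xy: "x = Suc x'" "y = Suc y'" "?Q \<subseteq> snd (bargraph_graph w)"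
      by auto
    then have "?E = ?Q" using sub by auto
    moreover have "card ?Q = 4" using xy by (simp add: doubleton_eq_iff)
    ultimately show ?L by (simp add: degree_def)
  qed
qed

lemma deg4_bargraph_graph:
  assumes w: "w \<in> fib_words n"
  shows "deg4 (bargraph_graph w) = card ((ones w \<union> Suc ` ones w) - {0, n})"
proof -
  let ?T = "ones w \<union> Suc ` ones w"
  have len: "length w = n" using w by (simp add: fib_words_iff)
  have "(x, y) \<in> fst (bargraph_graph w) \<and> degree (bargraph_graph w) (x, y) = 4 \<longleftrightarrow>
      x \<in> ?T - {0, n} \<and> y = 1" for x y
  proof (cases x)
    case 0
    then show ?thesis by (simp add: degree_eq_4_iff)
  next
    case (Suc a)
    \<comment> \<open>The two bounds with \<open>+ 1\<close> come from the left and right edges and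
      already imply the downward edge; the disjunction is the upward edge.\<close>
    have "(x, y) \<in> fst (bargraph_graph w) \<and> degree (bargraph_graph w) (x, y) = 4 \<longleftrightarrow>
        Suc a < n \<and> 1 \<le> y \<and> y \<le> w ! a + 1 \<and> y \<le> w ! Suc a + 1 \<and>
        (y \<le> w ! a \<or> y \<le> w ! Suc a)"
      unfolding degree_eq_4_iff Suc vertex_iff
      by (cases y) (auto simp: horizontal_edge_iff vertical_edge_iff len)
    \<comment> \<open>Two adjacent letters include a 0, so the horizontal edges force
      \<open>y = 1\<close>; the upward edge then requires one of the letters to be 1.\<close>
    also have "\<dots> \<longleftrightarrow> Suc a < n \<and> y = 1 \<and> (a \<in> ones w \<or> Suc a \<in> ones w)"
      using fib_word_nth[OF w, of a] fib_word_nth[OF w, of "Suc a"] ones_disjoint_shift[OF w]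
      by (auto split: if_splits)
    also have "\<dots> \<longleftrightarrow> x \<in> ?T - {0, n} \<and> y = 1"
      unfolding Suc by (auto simp: ones_def len)
    finally show ?thesis .
  qed
  then have "{v \<in> fst (bargraph_graph w). degree (bargraph_graph w) v = 4} = (?T - {0, n}) \<times> {1}"
    by auto
  then show ?thesis by (simp add: deg4_def card_cartesian_product)
qed

text \<open>Bounds suffice instead of a count of words with a 1 at either end: an error of at most 2
  per word is negligible against the length \<open>n\<close>.\<close>

lemma deg4_bargraph_graph_bounds:
  assumes w: "w \<in> fib_words n"
  shows "deg4 (bargraph_graph w) \<le> 2 * count_list w 1"
    and "2 * count_list w 1 \<le> deg4 (bargraph_graph w) + 2"
proof -
  let ?T = "ones w \<union> Suc ` ones w"
  have "card (?T - {0, n}) \<le> card ?T"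
    by (intro card_mono) (auto simp: finite_ones)
  moreover have "card ?T - card {0, n} \<le> card (?T - {0, n})"
    by (intro diff_card_le_card_Diff) auto
  moreover have "card {0, n} \<le> 2" by (simp add: card_insert_if)
  ultimately show "deg4 (bargraph_graph w) \<le> 2 * count_list w 1"
    "2 * count_list w 1 \<le> deg4 (bargraph_graph w) + 2"
    using card_ones_union_shift[OF w] by (simp_all add: deg4_bargraph_graph[OF w] card_ones)
qed

section \<open>Totals over all words and their asymptotics\<close>

lemma total_ver_eq:
  assumes "n > 0"
  shows "total_ver n = 2 * (n + 1) * card (fib_words n) + 2 * total_ones n"
proof -
  have "total_ver n = (\<Sum>w\<in>fib_words n. 2 * (n + 1) + 2 * count_list w 1)"
    unfolding total_ver_def using assms by (intro sum.cong refl ver_bargraph_graph)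
  also have "\<dots> = 2 * (n + 1) * card (fib_words n) + 2 * total_ones n"
    unfolding sum.distrib total_ones_def by (simp add: sum_distrib_left)
  finally show ?thesis .
qed

lemma total_deg4_bounds:
  shows "total_deg4 n \<le> 2 * total_ones n"
    and "2 * total_ones n \<le> total_deg4 n + 2 * card (fib_words n)"
proof -
  show "total_deg4 n \<le> 2 * total_ones n"
    unfolding total_deg4_def total_ones_def sum_distrib_left
    by (intro sum_mono deg4_bargraph_graph_bounds)
  have "2 * total_ones n \<le> (\<Sum>w\<in>fib_words n. deg4 (bargraph_graph w) + 2)"
    unfolding total_ones_def sum_distrib_left
    by (intro sum_mono deg4_bargraph_graph_bounds)
  then show "2 * total_ones n \<le> total_deg4 n + 2 * card (fib_words n)"
    unfolding sum.distrib by (simp add: total_deg4_def)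
qed

lemma fib_ratio_limit:
  "(\<lambda>n. real (fib n) / real (fib (n + 1))) \<longlonglongrightarrow> (sqrt 5 - 1) / 2"
proof -
  define \<phi> :: real where "\<phi> = (1 + sqrt 5) / 2"
  have pos: "\<phi> > 0" unfolding \<phi>_def by (simp add: add_pos_pos)
  have A: "(\<lambda>n. real (fib n) / (\<phi> ^ n / sqrt 5)) \<longlonglongrightarrow> 1"
    using fib_asymptotics by (simp add: \<phi>_def)
  \<comment> \<open>The normalised sequence is divided by its own shift; the powers cancel up to one
    factor \<phi>, which the last division removes.\<close>
  have "(\<lambda>n. real (fib n) / (\<phi> ^ n / sqrt 5) / (real (fib (n + 1)) / (\<phi> ^ (n + 1) / sqrt 5)) / \<phi>)
      \<longlonglongrightarrow> 1 / 1 / \<phi>"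
    using pos by (intro tendsto_intros A LIMSEQ_ignore_initial_segment[OF A]) auto
  moreover have "real (fib n) / (\<phi> ^ n / sqrt 5) / (real (fib (n + 1)) / (\<phi> ^ (n + 1) / sqrt 5)) / \<phi>
      = real (fib n) / real (fib (n + 1))" for n
    using pos by (simp add: field_simps)
  moreover have "1 / 1 / \<phi> = (sqrt 5 - 1) / 2"
    using pos by (simp add: \<phi>_def field_simps)
  ultimately show ?thesis by (simp only:)
qed

lemma ones_density_limit:
  "(\<lambda>n. real (total_ones n) / (real n * real (card (fib_words n)))) \<longlonglongrightarrow> (5 - sqrt 5) / 10"
proof -
  define r where "r n = real (fib n) / real (fib (n + 1))" for n
  have r: "r \<longlonglongrightarrow> (sqrt 5 - 1) / 2"
    unfolding r_def by (rule fib_ratio_limit)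
  have r1: "(\<lambda>n. r (n + 1)) \<longlonglongrightarrow> (sqrt 5 - 1) / 2"
    by (rule LIMSEQ_ignore_initial_segment[OF r])
  \<comment> \<open>This is the closed form of \<open>total_ones n\<close> divided by
    \<open>n * fib (n + 2)\<close>; the product \<open>r n * r (n + 1)\<close> telescopes to
    \<open>fib n / fib (n + 2)\<close>.\<close>
  have "(\<lambda>n. (r (n + 1) + 2 * (1 + 1 / real n) * (r n * r (n + 1))) / 5) \<longlonglongrightarrow>
      ((sqrt 5 - 1) / 2 + 2 * (1 + 0) * ((sqrt 5 - 1) / 2 * ((sqrt 5 - 1) / 2))) / 5"
    by (intro tendsto_intros r r1 lim_1_over_n) auto
  moreover have "((sqrt 5 - 1) / 2 + 2 * (1 + 0) * ((sqrt 5 - 1) / 2 * ((sqrt 5 - 1) / 2))) / 5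
      = (5 - sqrt 5) / 10"
    by (simp add: field_simps)
  moreover have "\<forall>\<^sub>F n in sequentially.
      (r (n + 1) + 2 * (1 + 1 / real n) * (r n * r (n + 1))) / 5 =
      real (total_ones n) / (real n * real (card (fib_words n)))"
    using eventually_gt_at_top[of 0]
  proof eventually_elim
    case (elim n)
    have F: "real (fib (n + 1)) > 0" "real (fib (n + 2)) > 0"
      by (simp_all add: fib_neq_0_nat del: fib.simps)
    have rr: "r n * r (n + 1) = real (fib n) / real (fib (n + 2))"
      using F by (simp add: r_def del: fib.simps)
    have "5 * real (total_ones n) = real n * real (fib (n + 1)) + 2 * (real n + 1) * real (fib n)"
      using arg_cong[OF total_ones_closed_form[of n], of real]
      by (simp add: algebra_simps del: fib.simps)
    then have t: "real (total_ones n) =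
        (real n * real (fib (n + 1)) + 2 * (real n + 1) * real (fib n)) / 5" by simp
    have "r (n + 1) = real (fib (n + 1)) / real (fib (n + 2))" by (simp add: r_def)
    then show ?case
      unfolding rr t card_fib_words using F elim by (simp add: field_simps del: fib.simps)
  qed
  ultimately show ?thesis
    by (simp only: Lim_transform_eventually)
qed

theorem theorem3p11:
  "(\<lambda>n. real (total_deg4 n) / real (total_ver n)) \<longlonglongrightarrow> (7 - sqrt 5) / 22"
proof -
  \<comment> \<open>Both totals are normalised by the number of letters in all words of length
    \<open>n\<close>, so \<open>a\<close> is the density of ones.\<close>
  define a where "a n = real (total_ones n) / (real n * real (card (fib_words n)))" for n
  define d where "d n = real (total_deg4 n) / (real n * real (card (fib_words n)))" for n
  have a: "a \<longlonglongrightarrow> (5 - sqrt 5) / 10"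
    unfolding a_def by (rule ones_density_limit)
  have card_pos: "real (card (fib_words n)) > 0" for n
    by (simp add: card_fib_words fib_neq_0_nat del: fib.simps)
  have d: "d \<longlonglongrightarrow> 2 * ((5 - sqrt 5) / 10)"
  proof (rule tendsto_sandwich)
    have "(\<lambda>n. 2 * a n - 2 * (1 / real n)) \<longlonglongrightarrow> 2 * ((5 - sqrt 5) / 10) - 2 * 0"
      by (intro tendsto_intros a lim_1_over_n)
    then show "(\<lambda>n. 2 * a n - 2 * (1 / real n)) \<longlonglongrightarrow> 2 * ((5 - sqrt 5) / 10)" by simp
    show "(\<lambda>n. 2 * a n) \<longlonglongrightarrow> 2 * ((5 - sqrt 5) / 10)"
      by (intro tendsto_intros a)
    show "\<forall>\<^sub>F n in sequentially. 2 * a n - 2 * (1 / real n) \<le> d n"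
      using eventually_gt_at_top[of 0]
    proof eventually_elim
      case (elim n)
      have "2 * real (total_ones n) \<le> real (total_deg4 n) + 2 * real (card (fib_words n))"
        using total_deg4_bounds(2)[of n] by linarith
      then have "(2 * real (total_ones n) - 2 * real (card (fib_words n))) /
          (real n * real (card (fib_words n))) \<le> d n"
        unfolding d_def by (intro divide_right_mono) auto
      then show ?case
        using elim card_pos[of n] by (simp add: a_def diff_divide_distrib)
    qed
    show "\<forall>\<^sub>F n in sequentially. d n \<le> 2 * a n"
    proof (intro always_eventually allI)
      fix n
      have "real (total_deg4 n) \<le> 2 * real (total_ones n)"
        using total_deg4_bounds(1)[of n] by linarith
      then show "d n \<le> 2 * a n"
        unfolding a_def d_def times_divide_eq_right by (intro divide_right_mono) auto
    qed
  qed
  have "sqrt 5 < 5"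
    using real_sqrt_less_mono[of 5 "5 ^ 2"] by simp
  then have nz: "2 * (1 + 0) + 2 * ((5 - sqrt 5) / 10) \<noteq> 0" by argo
  \<comment> \<open>Numerator and denominator of the ratio are both divided by the number of
    letters; the denominator is then the normalised \<open>total_ver n\<close>.\<close>
  have "(\<lambda>n. d n / (2 * (1 + 1 / real n) + 2 * a n)) \<longlonglongrightarrow>
      2 * ((5 - sqrt 5) / 10) / (2 * (1 + 0) + 2 * ((5 - sqrt 5) / 10))"
    by (intro tendsto_intros a d lim_1_over_n nz)
  moreover have "2 * ((5 - sqrt 5) / 10) / (2 * (1 + 0) + 2 * ((5 - sqrt 5) / 10))
      = (7 - sqrt 5) / 22"
    using nz by (simp add: field_simps)
  moreover have "\<forall>\<^sub>F n in sequentially. d n / (2 * (1 + 1 / real n) + 2 * a n) =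
      real (total_deg4 n) / real (total_ver n)"
    using eventually_gt_at_top[of 0]
  proof eventually_elim
    case (elim n)
    define m where "m = real n * real (card (fib_words n))"
    have m: "m > 0" using elim card_pos[of n] by (simp add: m_def)
    have "real (total_ver n) = 2 * (real n + 1) * real (card (fib_words n)) + 2 * real (total_ones n)"
      using arg_cong[OF total_ver_eq[OF elim], of real] by (simp add: algebra_simps)
    also have "\<dots> = m * (2 * (1 + 1 / real n) + 2 * a n)"
      using elim card_pos[of n] by (simp add: m_def a_def field_simps)
    finally show ?case
      using m by (simp add: d_def m_def[symmetric])
  qed
  ultimately show ?thesis
    by (simp only: Lim_transform_eventually)
qed

end
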